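(* Let $p$ be an odd prime with $p\mid n$, $G=\mathrm{PGL}_n(\mathbb{C})$, and let $\bar A$ be a toral elementary abelian $p$-subgroup of $G$ with $C_G(\bar A)$ connected. Then $\bar A$ has a generating set (an $\mathbb{F}_p$-basis) none of whose elements is $G$-conjugate to $e_{n/p}$.
   Context: Toral: contained in a maximal torus. With $\alpha=e^{2\pi i/p}$ and $n=pk$, $e_{n/p}$ is the image in $G$ of $\mathrm{diag}(I_k,\alpha I_k,\dots,\alpha^{p-1}I_k)$. *)

theory Defs
  imports "HOL-Analysis.Analysis"
begin

text \<open>We model G = PGL_n(C) through GL_n(C) = invertible matrices of type complex^'n^'n,
  with n = CARD('n). A subgroup of G is represented by its full preimage in GL_n(C),
  which is a subgroup containing all nonzero scalar matrices.\<close>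

text \<open>Matrix power (the power operator on vec types is componentwise, so we define our own).\<close>
primrec mpow :: "complex^'n^'n \<Rightarrow> nat \<Rightarrow> complex^'n^'n" where
  "mpow M 0 = mat 1"
| "mpow M (Suc m) = M ** mpow M m"

definition is_scalar :: "complex^'n^'n \<Rightarrow> bool" where
  "is_scalar M \<longleftrightarrow> (\<exists>c. M = mat c)"

definition diagonal_mat :: "complex^'n^'n \<Rightarrow> bool" where
  "diagonal_mat M \<longleftrightarrow> (\<forall>i j. i \<noteq> j \<longrightarrow> M $ i $ j = 0)"

text \<open>A is the preimage in GL_n(C) of a (finite) elementary abelian p-subgroup of PGL_n(C).\<close>
definition elem_abelian_preimage :: "nat \<Rightarrow> (complex^'n^'n) set \<Rightarrow> bool" where
  "elem_abelian_preimage p A \<longleftrightarrow>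
     (\<forall>a\<in>A. invertible a) \<and>
     (\<forall>c. c \<noteq> 0 \<longrightarrow> mat c \<in> A) \<and>
     (\<forall>a\<in>A. \<forall>b\<in>A. a ** b \<in> A) \<and>
     (\<forall>a\<in>A. matrix_inv a \<in> A) \<and>
     (\<forall>a\<in>A. \<forall>b\<in>A. \<exists>c. a ** b = mat c ** (b ** a)) \<and>
     (\<forall>a\<in>A. is_scalar (mpow a p)) \<and>
     (\<exists>F. finite F \<and> A = {mat c ** f | c f. c \<noteq> 0 \<and> f \<in> F})"

text \<open>Toral: contained in a maximal torus of PGL_n(C); all maximal tori are conjugate
  to the image of the diagonal torus.\<close>
definition toral :: "(complex^'n^'n) set \<Rightarrow> bool" where
  "toral A \<longleftrightarrow> (\<exists>g::complex^'n^'n. invertible g \<and> (\<forall>a\<in>A. diagonal_mat (g ** a ** matrix_inv g)))"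

text \<open>Preimage in GL_n(C) of the centralizer C_G(A-bar).\<close>
definition centralizer_preimage :: "(complex^'n^'n) set \<Rightarrow> (complex^'n^'n) set" where
  "centralizer_preimage A =
     {x. invertible x \<and> (\<forall>a\<in>A. \<exists>c. x ** a = mat c ** (a ** x))}"

text \<open>A fixed enumeration of the index type, used to write block-diagonal matrices.\<close>
definition idx_enum :: "'n::finite \<Rightarrow> nat" where
  "idx_enum = (SOME \<sigma>. bij_betw \<sigma> (UNIV::'n set) {..<CARD('n)})"

text \<open>diag(I_k, alpha I_k, ..., alpha^(p-1) I_k), alpha = exp(2 pi i/p), k = n/p.\<close>
definition e_mat :: "nat \<Rightarrow> complex^'n^'n" where
  "e_mat p = (\<chi> i j. if i = j
       then exp (2 * pi * \<i> / of_nat p) ^ (idx_enum i div (CARD('n) div p)) else 0)"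

text \<open>x (in GL_n) represents an element of PGL_n that is G-conjugate to e_{n/p}.\<close>
definition conj_to_e :: "nat \<Rightarrow> complex^'n^'n \<Rightarrow> bool" where
  "conj_to_e p x \<longleftrightarrow>
     (\<exists>(g::complex^'n^'n) c. invertible g \<and> c \<noteq> 0 \<and> x = mat c ** (g ** e_mat p ** matrix_inv g))"

text \<open>The images of the elements of bs in A-bar = A/C^* form an F_p-basis of A-bar:
  every element of A is uniquely (up to scalars) a product of powers with exponents < p.\<close>
definition Fp_basis :: "nat \<Rightarrow> (complex^'n^'n) set \<Rightarrow> (complex^'n^'n) list \<Rightarrow> bool" where
  "Fp_basis p A bs \<longleftrightarrow>
     set bs \<subseteq> A \<and>
     (\<forall>a\<in>A. \<exists>!m::nat \<Rightarrow> nat.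
        (\<forall>i. (i < length bs \<longrightarrow> m i < p) \<and> (i \<ge> length bs \<longrightarrow> m i = 0)) \<and>
        (\<exists>c. a = mat c ** foldr (**) (map (\<lambda>i. mpow (bs ! i) (m i)) [0..<length bs]) (mat 1)))"

end

theory Submission
  imports Defs
begin

text \<open>Conjugate A into the diagonal torus and record each a in A by the vector of ratios of
  its eigenvalues. Under componentwise multiplication these vectors form an elementary abelian
  p-group isomorphic to the image of A in PGL_n. Elements conjugate to e_{n/p} have trace 0,
  so it suffices to find an F_p-basis of vectors with nonzero coordinate sum. If there is none,
  such vectors lie in a proper subgroup, so some nontrivial character theta is trivial on them.
  Character sums then show that for each coordinate i, the coordinates j with
  u_j = theta(u) u_i for all u are as many as those with u_j = u_i; this yields a permutation
  pi of the coordinates with u_(pi i) = theta(u) u_i. The corresponding permutation matrix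
  centralizes the image of A but commutes with some a in A only up to a nontrivial p-th root
  of unity. Since this commutator scalar is locally constant on the centralizer, the
  centralizer is disconnected.\<close>

section \<open>Scalar, diagonal and permutation matrices\<close>

lemma mat_mult_nth: "(mat c ** (M::'a::comm_ring_1^'n^'n)) $ i $ j = c * M $ i $ j"
  unfolding matrix_matrix_mult_def mat_def
  by (simp, subst sum.remove[of _ i], auto)

lemma mult_mat_nth: "((M::'a::comm_ring_1^'n^'n) ** mat c) $ i $ j = M $ i $ j * c"
  unfolding matrix_matrix_mult_def mat_def
  by (simp, subst sum.remove[of _ j], auto)

lemma vec_power_nth: "((u::'a::comm_monoid_mult^'n) ^ k) $ i = (u $ i) ^ k"
  by (induction k) auto

lemma mat_commute: "mat c ** (M::'a::comm_ring_1^'n^'n) = M ** mat c"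
  by (simp add: vec_eq_iff mat_mult_nth mult_mat_nth mult.commute)

lemma mat_mult_mat: "mat a ** mat b = (mat (a * b) :: 'a::comm_ring_1^'n^'n)"
  by (simp add: vec_eq_iff mat_mult_nth) (simp add: mat_def)

lemma diagonal_mat_mult_left_nth: "diagonal_mat D \<Longrightarrow> (D ** M) $ i $ j = D $ i $ i * M $ i $ j"
  unfolding diagonal_mat_def matrix_matrix_mult_def
  by (simp, subst sum.remove[of _ i], auto)

lemma diagonal_mat_mult_right_nth: "diagonal_mat D \<Longrightarrow> (M ** D) $ i $ j = M $ i $ j * D $ j $ j"
  unfolding diagonal_mat_def matrix_matrix_mult_def
  by (simp, subst sum.remove[of _ j], auto)

lemma diagonal_mat_mult: "diagonal_mat D \<Longrightarrow> diagonal_mat E \<Longrightarrow> diagonal_mat (D ** E)"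
  by (simp add: diagonal_mat_def diagonal_mat_mult_left_nth)

lemma diagonal_mat_mpow:
  assumes "diagonal_mat D"
  shows "diagonal_mat (mpow D k) \<and> (\<forall>i. mpow D k $ i $ i = (D $ i $ i) ^ k)"
proof (induction k)
  case 0
  then show ?case by (simp add: diagonal_mat_def mat_def)
next
  case (Suc k)
  then show ?case using assms by (simp add: diagonal_mat_mult diagonal_mat_mult_left_nth)
qed

lemma invertible_diagonal_mat_nth_nonzero:
  fixes D :: "complex^'n^'n"
  assumes "diagonal_mat D" and "invertible D"
  shows "D $ i $ i \<noteq> 0"
proof
  assume "D $ i $ i = 0"
  obtain D' where "D ** D' = mat 1" using assms(2) unfolding invertible_def by blast
  then have "(D ** D') $ i $ i = 1" by (simp add: mat_def)
  with assms(1) \<open>D $ i $ i = 0\<close> show False by (simp add: diagonal_mat_mult_left_nth)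
qed

lemma invertible_ex_nth_nonzero:
  assumes "invertible (M::complex^'n^'n)"
  shows "\<exists>i j. M $ i $ j \<noteq> 0"
proof (rule ccontr)
  assume "\<not> (\<exists>i j. M $ i $ j \<noteq> 0)"
  then have "M = 0" by (simp add: vec_eq_iff)
  then have "(mat 1 :: complex^'n^'n) = 0" using assms by (simp add: invertible_def)
  then have "(mat 1 :: complex^'n^'n) $ undefined $ undefined = 0" by simp
  then show False by (simp add: mat_def)
qed

lemma mat_mult_cancel:
  assumes "invertible (M::complex^'n^'n)" and "mat a ** M = mat b ** M"
  shows "a = b"
proof -
  obtain i j where "M $ i $ j \<noteq> 0" using invertible_ex_nth_nonzero[OF assms(1)] by blast
  moreover have "a * M $ i $ j = b * M $ i $ j"
    using arg_cong[OF assms(2), of "\<lambda>N. N $ i $ j"] by (simp add: mat_mult_nth)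
  ultimately show ?thesis by simp
qed

lemma matrix_inv_inverse:
  "invertible (M::'a::semiring_1^'n^'n) \<Longrightarrow> M ** matrix_inv M = mat 1 \<and> matrix_inv M ** M = mat 1"
  unfolding invertible_def matrix_inv_def by (rule someI_ex)

lemma mpow_scalar_commutator:
  assumes "y ** a = mat c ** (a ** (y::complex^'n^'n))"
  shows "y ** mpow a k = mat (c ^ k) ** (mpow a k ** y)"
proof (induction k)
  case 0
  then show ?case by (simp add: mat_commute)
next
  case (Suc k)
  have "y ** mpow a (Suc k) = mat c ** a ** (y ** mpow a k)"
    using assms by (simp add: matrix_mul_assoc)
  also have "\<dots> = mat c ** a ** (mat (c ^ k) ** (mpow a k ** y))" using Suc by simp
  also have "\<dots> = mat c ** mat (c ^ k) ** (a ** mpow a k ** y)"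
    by (metis mat_commute matrix_mul_assoc)
  also have "\<dots> = mat (c ^ Suc k) ** (mpow a (Suc k) ** y)"
    by (simp add: mat_mult_mat matrix_mul_assoc)
  finally show ?case .
qed

lemma closed_scalar_commutator: "closed {y::complex^'n^'n. y ** a = mat z ** (a ** y)}"
proof -
  have "{y::complex^'n^'n. y ** a = mat z ** (a ** y)} =
      (\<Inter>i. \<Inter>j. {y. (y ** a) $ i $ j = z * (a ** y) $ i $ j})"
    by (auto simp: vec_eq_iff mat_mult_nth)
  moreover have "closed {y. (y ** a) $ i $ j = z * (a ** y) $ i $ j}" for i j
    unfolding matrix_matrix_mult_def by (auto intro!: closed_Collect_eq continuous_intros)
  ultimately show ?thesis by (simp add: closed_INT)
qed

lemma commutator_scalar_power_p:
  assumes "invertible y" and "mpow a p = mat s" "s \<noteq> 0" and "y ** a = mat c ** (a ** y)"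
  shows "c ^ p = 1"
proof -
  have "mat s ** y = y ** mat s" by (rule mat_commute)
  also have "\<dots> = mat (c ^ p * s) ** y"
    using mpow_scalar_commutator[OF assms(4), of p] assms(2) by (simp add: matrix_mul_assoc mat_mult_mat)
  finally have "s = c ^ p * s" using mat_mult_cancel[OF assms(1)] by blast
  then show ?thesis using assms(3) by simp
qed

lemma commutator_scalar_unique:
  fixes a y :: "complex^'n^'n"
  assumes "invertible (a ** y)" and "y ** a = mat w ** (a ** y)" "y ** a = mat w' ** (a ** y)"
  shows "w = w'"
  using assms(1) by (rule mat_mult_cancel) (simp only: assms(2,3)[symmetric])

lemma trace_mat_mult: "trace (mat c ** M) = c * trace (M::complex^'n^'n)"
  by (simp add: trace_def mat_mult_nth sum_distrib_left)

lemma trace_conjugate: "invertible (h::complex^'n^'n) \<Longrightarrow> trace (h ** M ** matrix_inv h) = trace M"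
  by (metis matrix_inv_inverse matrix_mul_assoc matrix_mul_lid trace_mul_sym)

definition perm_mat :: "('n \<Rightarrow> 'n) \<Rightarrow> complex^'n^'n" where
  "perm_mat \<pi> = (\<chi> r c. if r = \<pi> c then 1 else 0)"

lemma invertible_perm_mat:
  assumes "bij \<pi>"
  shows "invertible (perm_mat \<pi>)"
proof -
  have perm_eq: "(r = \<pi> k) \<longleftrightarrow> (k = inv \<pi> r)" for r k
    using assms by (auto simp: bij_inv_eq_iff)
  have "(perm_mat \<pi> ** perm_mat (inv \<pi>)) $ r $ s = mat 1 $ r $ s" for r s
  proof -
    have "(perm_mat \<pi> ** perm_mat (inv \<pi>)) $ r $ s =
        (\<Sum>k\<in>UNIV. if k = inv \<pi> r then perm_mat (inv \<pi>) $ k $ s else 0)"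
      unfolding matrix_matrix_mult_def vec_lambda_beta
      by (rule sum.cong) (auto simp: perm_mat_def perm_eq)
    also have "\<dots> = perm_mat (inv \<pi>) $ inv \<pi> r $ s" by simp
    also have "\<dots> = mat 1 $ r $ s"
      using assms by (auto simp: perm_mat_def mat_def bij_inv_eq_iff bij_is_surj surj_f_inv_f)
    finally show ?thesis .
  qed
  then have "perm_mat \<pi> ** perm_mat (inv \<pi>) = mat 1" by (simp add: vec_eq_iff)
  then show ?thesis
    using invertible_right_inverse by blast
qed

lemma diagonal_mat_mult_perm_mat:
  assumes "diagonal_mat D" and "\<And>c. D $ \<pi> c $ \<pi> c = z * D $ c $ c"
  shows "D ** perm_mat \<pi> = mat z ** (perm_mat \<pi> ** D)"
proof -
  have "(D ** perm_mat \<pi>) $ r $ c = (mat z ** (perm_mat \<pi> ** D)) $ r $ c" for r c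
    using assms
    by (cases "r = \<pi> c")
      (simp_all add: mat_mult_nth diagonal_mat_mult_left_nth diagonal_mat_mult_right_nth perm_mat_def)
  then show ?thesis by (simp add: vec_eq_iff)
qed

section \<open>Spans in elementary abelian p-groups\<close>

definition bounded_exps :: "nat \<Rightarrow> nat \<Rightarrow> (nat \<Rightarrow> nat) \<Rightarrow> bool" where
  "bounded_exps p L m \<longleftrightarrow> (\<forall>i. (i < L \<longrightarrow> m i < p) \<and> (i \<ge> L \<longrightarrow> m i = 0))"

definition power_prod :: "'a::comm_monoid_mult list \<Rightarrow> (nat \<Rightarrow> nat) \<Rightarrow> 'a" where
  "power_prod bs m = (\<Prod>i<length bs. (bs ! i) ^ m i)"

definition Fp_span :: "nat \<Rightarrow> 'a::comm_monoid_mult list \<Rightarrow> 'a set" where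
  "Fp_span p bs = power_prod bs ` {m. bounded_exps p (length bs) m}"

definition Fp_independent :: "nat \<Rightarrow> 'a::comm_monoid_mult list \<Rightarrow> bool" where
  "Fp_independent p bs \<longleftrightarrow> inj_on (power_prod bs) {m. bounded_exps p (length bs) m}"

lemma power_prod_snoc: "power_prod (bs @ [t]) m = power_prod bs m * t ^ m (length bs)"
  unfolding power_prod_def by (simp add: nth_append)

lemma power_prod_update_length: "power_prod bs (m(length bs := k)) = power_prod bs m"
  unfolding power_prod_def by (intro prod.cong) auto

lemma power_prod_append:
  assumes "\<forall>i\<ge>length bs. m i = 0"
  shows "power_prod (bs @ cs) m = power_prod bs m"
proof -
  have "power_prod (bs @ cs) m =
      (\<Prod>i\<in>{..<length bs} \<union> {length bs..<length bs + length cs}. ((bs @ cs) ! i) ^ m i)"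
    unfolding power_prod_def by (intro prod.cong) auto
  also have "\<dots> = (\<Prod>i<length bs. ((bs @ cs) ! i) ^ m i) *
      (\<Prod>i\<in>{length bs..<length bs + length cs}. ((bs @ cs) ! i) ^ m i)"
    by (intro prod.union_disjoint) auto
  also have "(\<Prod>i\<in>{length bs..<length bs + length cs}. ((bs @ cs) ! i) ^ m i) = 1"
    using assms by (intro prod.neutral) auto
  finally show ?thesis unfolding power_prod_def by (simp add: nth_append)
qed

lemma bounded_exps_restrict: "bounded_exps p (Suc L) m \<Longrightarrow> bounded_exps p L (m(L := 0))"
  unfolding bounded_exps_def by auto

lemma Fp_independent_Nil: "Fp_independent p []"
  unfolding Fp_independent_def bounded_exps_def by (intro inj_onI ext) auto

lemma power_prod_unit: "k < length bs \<Longrightarrow> power_prod bs (\<lambda>i. if i = k then 1 else 0) = bs ! k"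
  unfolding power_prod_def by (subst prod.remove[of _ k]) (auto intro!: prod.neutral)

definition Fp_coords :: "nat \<Rightarrow> 'a::comm_monoid_mult list \<Rightarrow> 'a \<Rightarrow> nat \<Rightarrow> nat" where
  "Fp_coords p bs u = (THE m. bounded_exps p (length bs) m \<and> power_prod bs m = u)"

definition multiplicative_on :: "'a::times set \<Rightarrow> ('a \<Rightarrow> 'b::times) \<Rightarrow> bool" where
  "multiplicative_on G \<theta> \<longleftrightarrow> (\<forall>u\<in>G. \<forall>v\<in>G. \<theta> (u * v) = \<theta> u * \<theta> v)"

lemma Fp_coords:
  assumes "Fp_independent p bs" and "u \<in> Fp_span p bs"
  shows "bounded_exps p (length bs) (Fp_coords p bs u)" and "power_prod bs (Fp_coords p bs u) = u"
proof -
  have "\<exists>!m. bounded_exps p (length bs) m \<and> power_prod bs m = u"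
    using assms unfolding Fp_independent_def Fp_span_def inj_on_def by blast
  from theI'[OF this] show "bounded_exps p (length bs) (Fp_coords p bs u)"
    and "power_prod bs (Fp_coords p bs u) = u"
    unfolding Fp_coords_def by auto
qed

lemma Fp_coords_power_prod:
  assumes "Fp_independent p bs" and "bounded_exps p (length bs) m"
  shows "Fp_coords p bs (power_prod bs m) = m"
proof -
  have "power_prod bs m \<in> Fp_span p bs" using assms(2) unfolding Fp_span_def by blast
  then show ?thesis
    using assms Fp_coords[of p bs "power_prod bs m"] unfolding Fp_independent_def inj_on_def by blast
qed

locale elem_abelian_pgroup =
  fixes G :: "'a::comm_monoid_mult set" and p :: nat
  assumes finite_G: "finite G" and one_in: "1 \<in> G"
    and mult_in: "\<And>u v. u \<in> G \<Longrightarrow> v \<in> G \<Longrightarrow> u * v \<in> G"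
    and power_p: "\<And>u. u \<in> G \<Longrightarrow> u ^ p = 1"
    and prime_p: "prime p"
begin

lemma p_gt_1: "p > 1"
  using prime_p prime_gt_1_nat by blast

lemma p_pos: "p > 0"
  using p_gt_1 by simp

lemma power_in: "u \<in> G \<Longrightarrow> u ^ k \<in> G"
  by (induction k) (auto simp: one_in mult_in)

lemma prod_in: "finite I \<Longrightarrow> (\<And>i. i \<in> I \<Longrightarrow> f i \<in> G) \<Longrightarrow> prod f I \<in> G"
  by (induction I rule: finite_induct) (auto simp: one_in mult_in)

lemma power_mod: "u \<in> G \<Longrightarrow> u ^ (k mod p) = u ^ k"
  by (metis power_p mod_mult_div_eq power_add power_mult power_one mult_1_right)

lemma mult_power_pred: "u \<in> G \<Longrightarrow> u * u ^ (p - 1) = 1"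
  using power_p p_gt_1 by (metis power_Suc Suc_diff_1 less_trans zero_less_one)

lemma mult_left_cancel: "u \<in> G \<Longrightarrow> u * v = u * w \<Longrightarrow> v = w"
  by (metis mult_power_pred mult.assoc mult.commute mult_1_left)

lemma power_prod_in: "set bs \<subseteq> G \<Longrightarrow> power_prod bs m \<in> G"
  unfolding power_prod_def by (intro prod_in) (auto intro!: power_in)

lemma Fp_span_subset: "set bs \<subseteq> G \<Longrightarrow> Fp_span p bs \<subseteq> G"
  unfolding Fp_span_def using power_prod_in by blast

lemma power_prod_mult:
  assumes "set bs \<subseteq> G"
  shows "power_prod bs m * power_prod bs m' = power_prod bs (\<lambda>i. (m i + m' i) mod p)"
  unfolding power_prod_def prod.distrib[symmetric]
proof (intro prod.cong refl)
  fix i assume "i \<in> {..<length bs}"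
  then have "bs ! i \<in> G" using assms by auto
  then show "bs ! i ^ m i * bs ! i ^ m' i = bs ! i ^ ((m i + m' i) mod p)"
    by (simp add: power_add power_mod)
qed

lemma bounded_exps_add:
  "bounded_exps p L m \<Longrightarrow> bounded_exps p L m' \<Longrightarrow> bounded_exps p L (\<lambda>i. (m i + m' i) mod p)"
  unfolding bounded_exps_def using p_pos by auto

lemma one_in_Fp_span: "1 \<in> Fp_span p bs"
  unfolding Fp_span_def
  by (rule image_eqI[of _ _ "\<lambda>_. 0"]) (auto simp: power_prod_def bounded_exps_def p_pos)

lemma Fp_span_mult:
  "set bs \<subseteq> G \<Longrightarrow> u \<in> Fp_span p bs \<Longrightarrow> v \<in> Fp_span p bs \<Longrightarrow> u * v \<in> Fp_span p bs"
  unfolding Fp_span_def using power_prod_mult bounded_exps_add by auto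

lemma Fp_span_power: "set bs \<subseteq> G \<Longrightarrow> u \<in> Fp_span p bs \<Longrightarrow> u ^ k \<in> Fp_span p bs"
  by (induction k) (auto simp: one_in_Fp_span Fp_span_mult)

lemma in_Fp_span_if_power_in:
  assumes "set bs \<subseteq> G" and "t \<in> G" and "0 < j" "j < p" and "t ^ j \<in> Fp_span p bs"
  shows "t \<in> Fp_span p bs"
proof -
  have "coprime j p"
    using assms(3,4) prime_p by (metis coprime_commute nat_dvd_not_less prime_imp_coprime_nat)
  then obtain x y where "j * x = p * y + 1"
    using bezout_nat[of j p] assms(3) by auto
  then have "(t ^ j) ^ x = t"
    using power_p[OF assms(2)] by (simp add: power_mult[symmetric] power_add power_mult)
  then show ?thesis
    using Fp_span_power[OF assms(1,5)] by metis
qed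

text \<open>Otherwise \<open>t ^ (k - k')\<close> would lie in the span, and then so would t.\<close>
lemma mult_power_neq_if_notin_Fp_span:
  assumes bs: "set bs \<subseteq> G" and t: "t \<in> G" "t \<notin> Fp_span p bs"
    and k: "k' < k" "k < p" and y: "y \<in> Fp_span p bs" "y' \<in> Fp_span p bs"
  shows "y * t ^ k \<noteq> y' * t ^ k'"
proof
  assume "y * t ^ k = y' * t ^ k'"
  then have "t ^ k' * (y * t ^ (k - k')) = t ^ k' * y'"
    using k(1) by (simp add: ac_simps power_add[symmetric])
  then have "y * t ^ (k - k') = y'" using mult_left_cancel power_in t(1) by blast
  then have "t ^ (k - k') = y' * y ^ (p - 1)"
    using mult_power_pred Fp_span_subset[OF bs] y(1) by (metis mult.assoc mult.commute mult_1_right subsetD)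
  then have "t ^ (k - k') \<in> Fp_span p bs"
    using y bs Fp_span_mult Fp_span_power by simp
  moreover have "0 < k - k'" "k - k' < p" using k by auto
  ultimately show False
    using in_Fp_span_if_power_in[OF bs t(1)] t(2) by blast
qed

lemma Fp_independent_snoc:
  assumes bs: "set bs \<subseteq> G" "Fp_independent p bs" and t: "t \<in> G" "t \<notin> Fp_span p bs"
  shows "Fp_independent p (bs @ [t])"
  unfolding Fp_independent_def
proof (rule inj_onI, unfold mem_Collect_eq)
  fix m m'
  assume m: "bounded_exps p (length (bs @ [t])) m" and m': "bounded_exps p (length (bs @ [t])) m'"
    and eq: "power_prod (bs @ [t]) m = power_prod (bs @ [t]) m'"
  define L where "L = length bs"
  have b: "bounded_exps p L (m(L := 0))" "bounded_exps p L (m'(L := 0))"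
    using m m' bounded_exps_restrict unfolding L_def by auto
  define x where "x = power_prod bs (m(L := 0))"
  define x' where "x' = power_prod bs (m'(L := 0))"
  have x: "x \<in> Fp_span p bs" "x' \<in> Fp_span p bs"
    using b unfolding x_def x'_def Fp_span_def L_def by auto
  have eq': "x * t ^ m L = x' * t ^ m' L"
    using eq unfolding power_prod_snoc x_def x'_def L_def power_prod_update_length .
  have k: "m L < p" "m' L < p" using m m' unfolding bounded_exps_def L_def by auto
  have same_t_exp: "m L = m' L"
  proof (rule ccontr)
    assume "m L \<noteq> m' L"
    then consider "m' L < m L" | "m L < m' L" by linarith
    then show False
    proof cases
      case 1
      from mult_power_neq_if_notin_Fp_span[OF bs(1) t 1 k(1) x] eq' show False by simp
    next
      case 2
      from mult_power_neq_if_notin_Fp_span[OF bs(1) t 2 k(2) x(2,1)] eq' show False by simp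
    qed
  qed
  then have "t ^ m L * x = t ^ m L * x'"
    using eq' by (simp add: mult.commute)
  then have "x = x'"
    by (rule mult_left_cancel[OF power_in[OF t(1)]])
  then have "m(L := 0) = m'(L := 0)"
    using bs(2) b unfolding Fp_independent_def inj_on_def x_def x'_def L_def by blast
  show "m = m'"
  proof
    fix i
    show "m i = m' i"
      using fun_cong[OF \<open>m(L := 0) = m'(L := 0)\<close>, of i] same_t_exp by (cases "i = L") auto
  qed
qed

lemma Fp_span_snoc_psubset:
  assumes "t \<notin> Fp_span p bs"
  shows "Fp_span p bs \<subset> Fp_span p (bs @ [t])"
proof -
  have "Fp_span p bs \<subseteq> Fp_span p (bs @ [t])"
  proof
    fix u assume "u \<in> Fp_span p bs"
    then obtain m where m: "bounded_exps p (length bs) m" "u = power_prod bs m"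
      unfolding Fp_span_def by auto
    then have "bounded_exps p (length (bs @ [t])) m"
      using p_pos unfolding bounded_exps_def by (auto simp: less_Suc_eq)
    moreover have "power_prod (bs @ [t]) m = u"
      using m unfolding power_prod_snoc bounded_exps_def by auto
    ultimately show "u \<in> Fp_span p (bs @ [t])" unfolding Fp_span_def by force
  qed
  moreover have "t \<in> Fp_span p (bs @ [t])"
  proof -
    have "bounded_exps p (length (bs @ [t])) (\<lambda>i. if i = length bs then 1 else 0)"
      unfolding bounded_exps_def using p_gt_1 by auto
    moreover have "power_prod (bs @ [t]) (\<lambda>i. if i = length bs then 1 else 0) = t"
      using power_prod_unit[of "length bs" "bs @ [t]"] by simp
    ultimately show ?thesis unfolding Fp_span_def by force
  qed
  ultimately show ?thesis using assms by blast
qed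

lemma Fp_independent_extend:
  assumes "T \<subseteq> G"
  shows "set bs \<subseteq> G \<Longrightarrow> Fp_independent p bs \<Longrightarrow>
    \<exists>cs. set cs \<subseteq> T \<and> Fp_independent p (bs @ cs) \<and> T \<subseteq> Fp_span p (bs @ cs)"
proof (induction "card G - card (Fp_span p bs)" arbitrary: bs rule: less_induct)
  case less
  show ?case
  proof (cases "T \<subseteq> Fp_span p bs")
    case True
    then show ?thesis using less.prems by (intro exI[of _ "[]"]) auto
  next
    case False
    then obtain t where t: "t \<in> T" "t \<notin> Fp_span p bs" by blast
    have bs': "set (bs @ [t]) \<subseteq> G" using less.prems t assms by auto
    have "card (Fp_span p bs) < card (Fp_span p (bs @ [t]))"
      using Fp_span_snoc_psubset[OF t(2)] Fp_span_subset[OF bs'] finite_G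
      by (meson psubset_card_mono rev_finite_subset)
    moreover have "card (Fp_span p (bs @ [t])) \<le> card G"
      using Fp_span_subset[OF bs'] finite_G by (simp add: card_mono)
    ultimately have "card G - card (Fp_span p (bs @ [t])) < card G - card (Fp_span p bs)"
      by linarith
    moreover have "Fp_independent p (bs @ [t])"
      using Fp_independent_snoc less.prems t assms by blast
    ultimately obtain cs where
      "set cs \<subseteq> T" "Fp_independent p ((bs @ [t]) @ cs)" "T \<subseteq> Fp_span p ((bs @ [t]) @ cs)"
      using less.hyps bs' by blast
    then show ?thesis using t by (intro exI[of _ "t # cs"]) auto
  qed
qed

lemma Fp_coords_mult:
  assumes "set bs \<subseteq> G" "Fp_independent p bs" and "u \<in> Fp_span p bs" "v \<in> Fp_span p bs"
  shows "Fp_coords p bs (u * v) = (\<lambda>i. (Fp_coords p bs u i + Fp_coords p bs v i) mod p)"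
proof -
  have "u * v = power_prod bs (\<lambda>i. (Fp_coords p bs u i + Fp_coords p bs v i) mod p)"
    using power_prod_mult[OF assms(1)] Fp_coords[OF assms(2)] assms(3,4) by metis
  then show ?thesis
    using Fp_coords_power_prod[OF assms(2)] bounded_exps_add Fp_coords(1)[OF assms(2)] assms(3,4)
    by metis
qed

lemma multiplicative_on_power_Fp_coord:
  fixes \<omega> :: "'b::comm_monoid_mult"
  assumes "set bs \<subseteq> G" "Fp_independent p bs" "G \<subseteq> Fp_span p bs" and "\<omega> ^ p = 1"
  shows "multiplicative_on G (\<lambda>u. \<omega> ^ Fp_coords p bs u k)"
proof (unfold multiplicative_on_def, intro ballI)
  fix u v assume "u \<in> G" "v \<in> G"
  then have "u \<in> Fp_span p bs" "v \<in> Fp_span p bs" using assms(3) by auto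
  then have "Fp_coords p bs (u * v) k = (Fp_coords p bs u k + Fp_coords p bs v k) mod p"
    by (simp add: Fp_coords_mult[OF assms(1,2)])
  moreover have "\<omega> ^ (j mod p) = \<omega> ^ j" for j
    by (metis assms(4) mod_mult_div_eq power_add power_mult power_one mult_1_right)
  ultimately show "\<omega> ^ Fp_coords p bs (u * v) k = \<omega> ^ Fp_coords p bs u k * \<omega> ^ Fp_coords p bs v k"
    by (simp add: power_add)
qed

lemma Fp_coords_nth:
  assumes "Fp_independent p bs" and "k < length bs"
  shows "Fp_coords p bs (bs ! k) = (\<lambda>i. if i = k then 1 else 0)"
proof -
  have "bounded_exps p (length bs) (\<lambda>i. if i = k then 1 else 0)"
    unfolding bounded_exps_def using p_gt_1 assms(2) by auto
  then show ?thesis using Fp_coords_power_prod[OF assms(1)] power_prod_unit[OF assms(2)] by metis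
qed

lemma Fp_coords_append_eq_0:
  assumes "Fp_independent p (cs @ ds)" and "u \<in> Fp_span p cs" and "length cs \<le> i"
  shows "Fp_coords p (cs @ ds) u i = 0"
proof -
  obtain m where m: "bounded_exps p (length cs) m" "u = power_prod cs m"
    using assms(2) unfolding Fp_span_def by auto
  then have "bounded_exps p (length (cs @ ds)) m"
    using p_pos unfolding bounded_exps_def by (metis le_trans length_append le_add1 not_le)
  moreover have "u = power_prod (cs @ ds) m"
    using m unfolding bounded_exps_def by (simp add: power_prod_append)
  ultimately have "Fp_coords p (cs @ ds) u = m" using Fp_coords_power_prod[OF assms(1)] by simp
  then show ?thesis using m(1) assms(3) unfolding bounded_exps_def by simp
qed

text \<open>Extend a maximal independent list from T to a basis of G; the first new coordinate
  gives the character.\<close>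
lemma basis_or_character:
  fixes \<omega> :: "'b::comm_monoid_mult"
  assumes T: "T \<subseteq> G" and \<omega>: "\<omega> ^ p = 1" "\<omega> \<noteq> 1"
  shows "(\<exists>cs. set cs \<subseteq> T \<and> Fp_independent p cs \<and> G \<subseteq> Fp_span p cs) \<or>
    (\<exists>\<theta>::'a \<Rightarrow> 'b. multiplicative_on G \<theta> \<and> (\<forall>u\<in>G. \<theta> u ^ p = 1) \<and>
       (\<forall>u\<in>T. \<theta> u = 1) \<and> (\<exists>u\<in>G. \<theta> u \<noteq> 1))"
proof -
  obtain cs where cs: "set cs \<subseteq> T" "Fp_independent p cs" "T \<subseteq> Fp_span p cs"
    using Fp_independent_extend[OF T, of "[]"] Fp_independent_Nil by auto
  have csG: "set cs \<subseteq> G" using cs T by auto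
  obtain ds where ds: "set ds \<subseteq> G" "Fp_independent p (cs @ ds)" "G \<subseteq> Fp_span p (cs @ ds)"
    using Fp_independent_extend[of G cs] csG cs by auto
  show ?thesis
  proof (cases "ds = []")
    case True
    then show ?thesis using cs ds by auto
  next
    case False
    define bs where "bs = cs @ ds"
    define k where "k = length cs"
    have k: "k < length bs" using False unfolding bs_def k_def by simp
    have bsG: "set bs \<subseteq> G" using csG ds unfolding bs_def by auto
    have indep: "Fp_independent p bs" and span: "G \<subseteq> Fp_span p bs"
      using ds unfolding bs_def by auto
    define \<theta> where "\<theta> u = \<omega> ^ Fp_coords p bs u k" for u
    have "multiplicative_on G \<theta>"
      unfolding \<theta>_def by (rule multiplicative_on_power_Fp_coord[OF bsG indep span \<omega>(1)])
    moreover have "\<forall>u\<in>G. \<theta> u ^ p = 1"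
      unfolding \<theta>_def by (simp add: power_mult[symmetric] mult.commute[of _ p] power_mult \<omega>)
    moreover have "\<forall>u\<in>T. \<theta> u = 1"
      using Fp_coords_append_eq_0[OF ds(2)] cs(3) unfolding \<theta>_def bs_def k_def by auto
    moreover have "\<theta> (bs ! k) = \<omega>"
      unfolding \<theta>_def Fp_coords_nth[OF indep k] by simp
    moreover have "bs ! k \<in> G" using bsG k by auto
    ultimately show ?thesis using \<omega>(2) by blast
  qed
qed

lemma character_sum_eq_0:
  fixes \<theta> :: "'a \<Rightarrow> 'b::idom"
  assumes "multiplicative_on G \<theta>" and "v \<in> G" "\<theta> v \<noteq> 1"
  shows "(\<Sum>u\<in>G. \<theta> u) = 0"
proof -
  have "bij_betw ((*) v) G G"
  proof (rule bij_betw_imageI)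
    show "inj_on ((*) v) G" using mult_left_cancel[OF assms(2)] by (auto simp: inj_on_def)
    show "(*) v ` G = G"
    proof
      show "(*) v ` G \<subseteq> G" using mult_in assms(2) by auto
      show "G \<subseteq> (*) v ` G"
      proof
        fix w assume "w \<in> G"
        then have "v ^ (p - 1) * w \<in> G" using mult_in power_in assms(2) by blast
        moreover have "w = v * (v ^ (p - 1) * w)"
          using mult_power_pred[OF assms(2)] by (simp add: mult.assoc[symmetric])
        ultimately show "w \<in> (*) v ` G" by blast
      qed
    qed
  qed
  then have "(\<Sum>u\<in>G. \<theta> u) = (\<Sum>u\<in>G. \<theta> (v * u))"
    using sum.reindex_bij_betw by metis
  also have "\<dots> = \<theta> v * (\<Sum>u\<in>G. \<theta> u)"
    using assms(1,2) unfolding multiplicative_on_def by (simp add: sum_distrib_left)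
  finally have "(\<theta> v - 1) * (\<Sum>u\<in>G. \<theta> u) = 0" by (simp add: algebra_simps)
  then show ?thesis using assms(3) by simp
qed

end

section \<open>Characters and coordinate counting\<close>

lemma sum_coords_div_character:
  fixes G :: "(complex^'n) set"
  assumes G: "elem_abelian_pgroup G p"
    and \<psi>: "multiplicative_on G \<psi>" "\<forall>u\<in>G. \<psi> u \<noteq> 0"
  shows "(\<Sum>u\<in>G. (\<Sum>j\<in>UNIV. u $ j) / \<psi> u) = of_nat (card G) * of_nat (card {j. \<forall>u\<in>G. u $ j = \<psi> u})"
proof -
  interpret elem_abelian_pgroup G p by (rule G)
  have coord_sum: "(\<Sum>u\<in>G. u $ j / \<psi> u) = (if \<forall>u\<in>G. u $ j = \<psi> u then of_nat (card G) else 0)" for j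
  proof (cases "\<forall>u\<in>G. u $ j = \<psi> u")
    case True
    then have "(\<Sum>u\<in>G. u $ j / \<psi> u) = (\<Sum>u\<in>G. 1)" using \<psi>(2) by (intro sum.cong) auto
    then show ?thesis using True by simp
  next
    case False
    then obtain v where "v \<in> G" "v $ j / \<psi> v \<noteq> 1" using \<psi>(2) by auto
    moreover have "multiplicative_on G (\<lambda>u. u $ j / \<psi> u)"
      using \<psi> unfolding multiplicative_on_def by auto
    ultimately show ?thesis using False character_sum_eq_0 by auto
  qed
  have "(\<Sum>u\<in>G. (\<Sum>j\<in>UNIV. u $ j) / \<psi> u) = (\<Sum>j\<in>UNIV. \<Sum>u\<in>G. u $ j / \<psi> u)"
    by (simp add: sum_divide_distrib sum.swap[of _ G])
  also have "\<dots> = of_nat (card G) * of_nat (card {j. \<forall>u\<in>G. u $ j = \<psi> u})"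
    by (simp add: coord_sum sum.If_cases)
  finally show ?thesis .
qed

text \<open>Both cardinalities are computed by character sums, which agree because \<open>\<theta> u = 1\<close>
  whenever the coordinate sum of u is nonzero.\<close>
lemma card_twisted_coords_eq:
  fixes G :: "(complex^'n) set"
  assumes G: "elem_abelian_pgroup G p" and nonzero: "\<forall>u\<in>G. \<forall>i. u $ i \<noteq> 0"
    and \<theta>: "multiplicative_on G \<theta>" "\<forall>u\<in>G. \<theta> u \<noteq> 0"
    and trivial: "\<forall>u\<in>G. (\<Sum>j\<in>UNIV. u $ j) \<noteq> 0 \<longrightarrow> \<theta> u = 1"
  shows "card {j. \<forall>u\<in>G. u $ j = \<theta> u * u $ i} = card {j. \<forall>u\<in>G. u $ j = u $ i}"
proof -
  interpret elem_abelian_pgroup G p by (rule G)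
  have "(of_nat (card G) :: complex) * of_nat (card {j. \<forall>u\<in>G. u $ j = \<theta> u * u $ i}) =
      (\<Sum>u\<in>G. (\<Sum>j\<in>UNIV. u $ j) / (\<theta> u * u $ i))"
    using \<theta> nonzero
    by (intro sum_coords_div_character[OF G, symmetric]) (auto simp: multiplicative_on_def)
  also have "\<dots> = (\<Sum>u\<in>G. (\<Sum>j\<in>UNIV. u $ j) / u $ i)"
    using trivial by (intro sum.cong) auto
  also have "\<dots> = of_nat (card G) * of_nat (card {j. \<forall>u\<in>G. u $ j = u $ i})"
    using nonzero by (intro sum_coords_div_character[OF G]) (auto simp: multiplicative_on_def)
  moreover have "card G \<noteq> 0" using finite_G one_in by auto
  ultimately show ?thesis by simp
qed

text \<open>The coordinates fall into classes of coordinates agreeing on all of G, and the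
  cardinality condition says that twisting by \<open>\<theta>\<close> maps each class onto a class of the same
  size; matching them up gives the permutation.\<close>
lemma ex_bij_twisting_coords:
  fixes G :: "(complex^'n) set"
  assumes \<theta>: "\<forall>u\<in>G. \<theta> u \<noteq> 0"
    and card_eq: "\<And>i. card {j. \<forall>u\<in>G. u $ j = \<theta> u * u $ i} = card {j. \<forall>u\<in>G. u $ j = u $ i}"
  shows "\<exists>\<pi>. bij \<pi> \<and> (\<forall>i. \<forall>u\<in>G. u $ \<pi> i = \<theta> u * u $ i)"
proof -
  define R where "R i = {j. \<forall>u\<in>G. u $ j = u $ i}" for i
  define T where "T i = {j. \<forall>u\<in>G. u $ j = \<theta> u * u $ i}" for i
  define B where "B i = (SOME b. bij_betw b (R i) (T i))" for i
  have B: "bij_betw (B i) (R i) (T i)" for i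
  proof -
    have "\<exists>b. bij_betw b (R i) (T i)"
      using finite_same_card_bij[of "R i" "T i"] card_eq unfolding R_def T_def by auto
    then show ?thesis unfolding B_def by (rule someI_ex)
  qed
  define \<pi> where "\<pi> i = B i i" for i
  have R: "i \<in> R i" for i unfolding R_def by auto
  have T: "\<pi> i \<in> T i" for i unfolding \<pi>_def using B[of i] R[of i] by (auto simp: bij_betw_def)
  have "inj \<pi>"
  proof (rule injI)
    fix i i' assume eq: "\<pi> i = \<pi> i'"
    have "\<forall>u\<in>G. u $ i = u $ i'"
      using T[of i] T[of i'] eq \<theta> unfolding T_def by auto
    then have "R i = R i'" "T i = T i'" "i' \<in> R i"
      unfolding R_def T_def by auto
    then have "B i = B i'" "i' \<in> R i" unfolding B_def by auto
    then show "i = i'" using eq B[of i] R[of i] unfolding \<pi>_def by (auto simp: bij_betw_def inj_on_def)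
  qed
  then have "bij \<pi>" using finite_UNIV_inj_surj[of \<pi>] by (simp add: bij_def)
  moreover have "\<forall>i. \<forall>u\<in>G. u $ \<pi> i = \<theta> u * u $ i" using T unfolding T_def by auto
  ultimately show ?thesis by blast
qed

section \<open>The trace of e_{n/p}\<close>

lemma sum_lessThan_mult_div: "(\<Sum>m<q * k. f (m div k)) = of_nat k * (\<Sum>j<q. f j :: 'a::comm_semiring_1)"
proof (induction q)
  case 0
  then show ?case by simp
next
  case (Suc q)
  have blocks: "{..<Suc q * k} = {..<q * k} \<union> {q * k..<q * k + k}" by auto
  have "(\<Sum>m<Suc q * k. f (m div k)) = (\<Sum>m\<in>{..<q * k} \<union> {q * k..<q * k + k}. f (m div k))"
    by (simp only: blocks)
  also have "\<dots> = (\<Sum>m<q * k. f (m div k)) + (\<Sum>m\<in>{q * k..<q * k + k}. f (m div k))"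
    by (rule sum.union_disjoint) auto
  also have "(\<Sum>m\<in>{q * k..<q * k + k}. f (m div k)) = (\<Sum>m\<in>{q * k..<q * k + k}. f q)"
  proof (intro sum.cong refl)
    fix m assume "m \<in> {q * k..<q * k + k}"
    then have "m div k = q" by (auto intro!: div_nat_eqI simp: algebra_simps)
    then show "f (m div k) = f q" by simp
  qed
  finally show ?case using Suc by (simp add: algebra_simps)
qed

lemma idx_enum_bij: "bij_betw (idx_enum :: 'n::finite \<Rightarrow> nat) UNIV {..<CARD('n)}"
proof -
  have "\<exists>h::'n \<Rightarrow> nat. bij_betw h UNIV {..<CARD('n)}"
    using ex_bij_betw_finite_nat[of "UNIV::'n set"] by (auto simp: atLeast0LessThan)
  then show ?thesis unfolding idx_enum_def by (rule someI_ex)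
qed

lemma primitive_root_of_unity:
  assumes "p > 1"
  shows "exp (2 * pi * \<i> / of_nat p) ^ p = 1" and "exp (2 * pi * \<i> / of_nat p) \<noteq> 1"
proof -
  have "exp (2 * pi * \<i> / of_nat p) ^ p = exp (2 * pi * \<i> / of_nat p * of_nat p)"
    by (simp only: exp_of_nat2_mult)
  also have "\<dots> = 1" using assms by (simp add: exp_two_pi_i)
  finally show "exp (2 * pi * \<i> / of_nat p) ^ p = 1" .
  have "exp (2 * complex_of_real pi * \<i> * of_nat 1 / of_nat p) \<noteq> 1"
    using complex_root_unity_eq_1[where n=p and j=1] assms by simp
  then show "exp (2 * pi * \<i> / of_nat p) \<noteq> 1" by simp
qed

lemma trace_e_mat:
  assumes "p > 1" and "p dvd CARD('n)"
  shows "trace (e_mat p :: complex^'n^'n) = 0"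
proof -
  define \<omega> where "\<omega> = exp (2 * pi * \<i> / of_nat p)"
  define k where "k = CARD('n) div p"
  have n: "CARD('n) = p * k" using assms unfolding k_def by simp
  have "trace (e_mat p :: complex^'n^'n) = (\<Sum>i\<in>UNIV. \<omega> ^ (idx_enum (i::'n) div k))"
    unfolding trace_def e_mat_def \<omega>_def k_def by simp
  also have "\<dots> = (\<Sum>m<CARD('n). \<omega> ^ (m div k))"
    using sum.reindex_bij_betw[OF idx_enum_bij, of "\<lambda>m. \<omega> ^ (m div k)"] by simp
  also have "\<dots> = of_nat k * (\<Sum>j<p. \<omega> ^ j)"
    unfolding n using sum_lessThan_mult_div[where q=p and k=k and f="\<lambda>j. \<omega> ^ j"] by simp
  also have "(\<Sum>j<p. \<omega> ^ j) = 0"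
    using geometric_sum[of \<omega> p] primitive_root_of_unity[OF assms(1)] unfolding \<omega>_def by simp
  finally show ?thesis by simp
qed

lemma trace_eq_0_if_conj_to_e:
  assumes "p > 1" and "p dvd CARD('n)" and "conj_to_e p (b::complex^'n^'n)"
  shows "trace b = 0"
  using assms(3) unfolding conj_to_e_def
  by (auto simp: trace_mat_mult trace_conjugate trace_e_mat[OF assms(1,2)])

section \<open>Simultaneous diagonalization of A\<close>

lemma prod_list_map_upt: "prod_list (map f [0..<L]) = (\<Prod>i<L. f i)"
  by (induction L) (auto simp: prod.lessThan_Suc mult.commute)

definition mpow_prod :: "(complex^'n^'n) list \<Rightarrow> (nat \<Rightarrow> nat) \<Rightarrow> complex^'n^'n" where
  "mpow_prod bs m = foldr (**) (map (\<lambda>i. mpow (bs ! i) (m i)) [0..<length bs]) (mat 1)"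

lemma Fp_basis_iff:
  "Fp_basis p A bs \<longleftrightarrow> set bs \<subseteq> A \<and>
    (\<forall>a\<in>A. \<exists>!m. bounded_exps p (length bs) m \<and> (\<exists>c. a = mat c ** mpow_prod bs m))"
  unfolding Fp_basis_def bounded_exps_def mpow_prod_def by (rule refl)

locale simultaneous_diagonalization =
  fixes p :: nat and A :: "(complex^'n^'n) set" and g :: "complex^'n^'n"
  assumes prime_p: "prime p" and elem_abelian: "elem_abelian_preimage p A"
    and invertible_g: "invertible g"
    and diagonal_conj: "\<forall>a\<in>A. diagonal_mat (g ** a ** matrix_inv g)"
begin

definition diag_form :: "complex^'n^'n \<Rightarrow> complex^'n^'n" where
  "diag_form a = g ** a ** matrix_inv g"

text \<open>Normalizing by the eigenvalue at an arbitrary fixed index makes the vector invariant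
  under scalars, so it only depends on the image of a in PGL_n.\<close>
definition eigen_ratios :: "complex^'n^'n \<Rightarrow> complex^'n" where
  "eigen_ratios a = (\<chi> i. diag_form a $ i $ i / diag_form a $ undefined $ undefined)"

lemma g_inverse: "g ** matrix_inv g = mat 1" "matrix_inv g ** g = mat 1"
  using matrix_inv_inverse[OF invertible_g] by auto

lemma invertible_if_in_A: "a \<in> A \<Longrightarrow> invertible a"
  using elem_abelian unfolding elem_abelian_preimage_def by auto

lemma mat_in_A: "c \<noteq> 0 \<Longrightarrow> mat c \<in> A"
  using elem_abelian unfolding elem_abelian_preimage_def by auto

lemma mult_in_A: "a \<in> A \<Longrightarrow> b \<in> A \<Longrightarrow> a ** b \<in> A"
  using elem_abelian unfolding elem_abelian_preimage_def by auto

lemma mpow_in_A: "a \<in> A \<Longrightarrow> mpow a k \<in> A"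
  by (induction k) (auto simp: mat_in_A mult_in_A)

lemma scalar_mpow_p: "a \<in> A \<Longrightarrow> is_scalar (mpow a p)"
  using elem_abelian unfolding elem_abelian_preimage_def by auto

lemma diag_form_mult: "diag_form (a ** b) = diag_form a ** diag_form b"
proof -
  have "diag_form a ** diag_form b = g ** a ** (matrix_inv g ** g) ** b ** matrix_inv g"
    unfolding diag_form_def by (simp add: matrix_mul_assoc)
  then show ?thesis unfolding diag_form_def g_inverse by (simp add: matrix_mul_assoc)
qed

lemma diag_form_mat: "diag_form (mat c) = mat c"
  unfolding diag_form_def by (metis g_inverse(1) mat_commute matrix_mul_assoc matrix_mul_lid)

lemma diag_form_inverse: "matrix_inv g ** diag_form a ** g = a"
  unfolding diag_form_def
  by (simp add: matrix_mul_assoc g_inverse) (simp add: matrix_mul_assoc[symmetric] g_inverse)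

lemma diag_form_of_conj: "diag_form (matrix_inv g ** M ** g) = M"
  unfolding diag_form_def
  by (simp add: matrix_mul_assoc g_inverse) (simp add: matrix_mul_assoc[symmetric] g_inverse)

lemma diag_form_inject: "diag_form a = diag_form b \<Longrightarrow> a = b"
  by (metis diag_form_inverse)

lemma invertible_matrix_inv_g: "invertible (matrix_inv g)"
  using g_inverse invertible_def by blast

lemma diagonal_diag_form: "a \<in> A \<Longrightarrow> diagonal_mat (diag_form a)"
  using diagonal_conj unfolding diag_form_def by auto

lemma diag_form_nth_nonzero: "a \<in> A \<Longrightarrow> diag_form a $ i $ i \<noteq> 0"
proof -
  assume "a \<in> A"
  then have "invertible (diag_form a)"
    unfolding diag_form_def
    using invertible_mult[OF invertible_mult[OF invertible_g invertible_if_in_A] invertible_matrix_inv_g]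
    by blast
  then show ?thesis using invertible_diagonal_mat_nth_nonzero diagonal_diag_form \<open>a \<in> A\<close> by blast
qed

lemma eigen_ratios_mult: "a \<in> A \<Longrightarrow> eigen_ratios (a ** b) = eigen_ratios a * eigen_ratios b"
  unfolding eigen_ratios_def
  by (simp add: vec_eq_iff diag_form_mult diagonal_mat_mult_left_nth diagonal_diag_form)

lemma eigen_ratios_mat_mult: "c \<noteq> 0 \<Longrightarrow> eigen_ratios (mat c ** a) = eigen_ratios a"
  unfolding eigen_ratios_def diag_form_mult diag_form_mat by (simp add: vec_eq_iff mat_mult_nth)

lemma eigen_ratios_mat_1: "eigen_ratios (mat 1) = 1"
  unfolding eigen_ratios_def diag_form_mat by (simp add: vec_eq_iff mat_def)

lemma eigen_ratios_nth_nonzero: "a \<in> A \<Longrightarrow> eigen_ratios a $ i \<noteq> 0"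
  unfolding eigen_ratios_def using diag_form_nth_nonzero by simp

lemma eigen_ratios_mpow: "a \<in> A \<Longrightarrow> eigen_ratios (mpow a k) = eigen_ratios a ^ k"
  by (induction k) (simp_all add: eigen_ratios_mat_1 eigen_ratios_mult mpow_in_A)

lemma eigen_ratios_eq_imp_scalar:
  assumes a: "a \<in> A" and b: "b \<in> A" and eq: "eigen_ratios a = eigen_ratios b"
  shows "\<exists>c. a = mat c ** b"
proof -
  define c where "c = diag_form a $ undefined $ undefined / diag_form b $ undefined $ undefined"
  have "diag_form a $ i $ i = c * diag_form b $ i $ i" for i
    using arg_cong[OF eq, of "\<lambda>v. v $ i"] diag_form_nth_nonzero[OF a] diag_form_nth_nonzero[OF b]
    unfolding eigen_ratios_def c_def by (simp add: field_simps)
  then have "diag_form a = mat c ** diag_form b"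
    using diagonal_diag_form[OF a] diagonal_diag_form[OF b] unfolding diagonal_mat_def
    by (simp add: vec_eq_iff mat_mult_nth) (metis mult_zero_right)
  then have "matrix_inv g ** diag_form a ** g = mat c ** (matrix_inv g ** diag_form b ** g)"
    by (metis mat_commute matrix_mul_assoc)
  then show ?thesis unfolding diag_form_inverse by blast
qed

lemma mpow_p_eq_mat:
  assumes "a \<in> A"
  obtains s where "s \<noteq> 0" "mpow a p = mat s" "\<And>i. (diag_form a $ i $ i) ^ p = s"
proof -
  obtain s where s: "mpow a p = mat s" using scalar_mpow_p[OF assms] unfolding is_scalar_def by blast
  have diag_form_mpow: "diag_form (mpow a k) = mpow (diag_form a) k" for k
    by (induction k) (simp_all add: diag_form_mat diag_form_mult)
  have "mpow (diag_form a) p = mat s" by (metis diag_form_mpow s diag_form_mat)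
  then have "(diag_form a $ i $ i) ^ p = s" for i
    using diagonal_mat_mpow[OF diagonal_diag_form[OF assms], of p] by (simp add: mat_def)
  moreover have "s \<noteq> 0"
    using calculation diag_form_nth_nonzero[OF assms] by (metis power_not_zero)
  ultimately show ?thesis using s that by blast
qed

lemma eigen_ratios_power_p:
  assumes "a \<in> A"
  shows "eigen_ratios a ^ p = 1"
proof -
  obtain s where "s \<noteq> 0" "\<And>i. (diag_form a $ i $ i) ^ p = s" using mpow_p_eq_mat[OF assms] by blast
  then show ?thesis by (simp add: eigen_ratios_def vec_eq_iff vec_power_nth power_divide)
qed

lemma elem_abelian_pgroup_eigen_ratios: "elem_abelian_pgroup (eigen_ratios ` A) p"
proof
  have "\<exists>F. finite F \<and> A = {mat c ** f | c f. c \<noteq> 0 \<and> f \<in> F}"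
    using elem_abelian unfolding elem_abelian_preimage_def by auto
  then obtain F where "finite F" "A = {mat c ** f | c f. c \<noteq> 0 \<and> f \<in> F}" by blast
  then have "eigen_ratios ` A \<subseteq> eigen_ratios ` F" using eigen_ratios_mat_mult by auto
  then show "finite (eigen_ratios ` A)" using \<open>finite F\<close> by (meson finite_imageI finite_subset)
  show "1 \<in> eigen_ratios ` A" using eigen_ratios_mat_1 mat_in_A[of 1] by force
  show "u * v \<in> eigen_ratios ` A" if uv: "u \<in> eigen_ratios ` A" "v \<in> eigen_ratios ` A" for u v
  proof -
    obtain a b where "a \<in> A" "b \<in> A" "u = eigen_ratios a" "v = eigen_ratios b" using uv by blast
    then show ?thesis using eigen_ratios_mult mult_in_A by (metis image_eqI)
  qed
  show "u ^ p = 1" if "u \<in> eigen_ratios ` A" for u using that eigen_ratios_power_p by auto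
  show "prime p" by (rule prime_p)
qed

lemma sum_eigen_ratios: "(\<Sum>j\<in>UNIV. eigen_ratios a $ j) = trace a / diag_form a $ undefined $ undefined"
proof -
  have "trace (diag_form a) = trace a"
    unfolding diag_form_def by (metis g_inverse(2) matrix_mul_assoc matrix_mul_lid trace_mul_sym)
  then show ?thesis unfolding eigen_ratios_def trace_def by (simp add: sum_divide_distrib[symmetric])
qed

lemma foldr_mult_in_A:
  "set Ms \<subseteq> A \<Longrightarrow> foldr (**) Ms (mat 1) \<in> A \<and>
    eigen_ratios (foldr (**) Ms (mat 1)) = prod_list (map eigen_ratios Ms)"
  by (induction Ms) (auto simp: mat_in_A mult_in_A eigen_ratios_mat_1 eigen_ratios_mult)

lemma mpow_prod_in_A:
  assumes "set bs \<subseteq> A"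
  shows "mpow_prod bs m \<in> A" and "eigen_ratios (mpow_prod bs m) = power_prod (map eigen_ratios bs) m"
proof -
  have "set (map (\<lambda>i. mpow (bs ! i) (m i)) [0..<length bs]) \<subseteq> A"
    using assms by (auto intro!: mpow_in_A)
  then have "mpow_prod bs m \<in> A \<and>
      eigen_ratios (mpow_prod bs m) = (\<Prod>i<length bs. eigen_ratios (mpow (bs ! i) (m i)))"
    using foldr_mult_in_A unfolding mpow_prod_def by (simp add: prod_list_map_upt)
  moreover have "bs ! i \<in> A" if "i < length bs" for i using assms nth_mem[OF that] by blast
  then have "(\<Prod>i<length bs. eigen_ratios (mpow (bs ! i) (m i))) = power_prod (map eigen_ratios bs) m"
    unfolding power_prod_def by (intro prod.cong) (auto simp: eigen_ratios_mpow)
  ultimately show "mpow_prod bs m \<in> A" "eigen_ratios (mpow_prod bs m) = power_prod (map eigen_ratios bs) m"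
    by auto
qed

lemma Fp_basis_lift:
  assumes cs: "set cs \<subseteq> eigen_ratios ` A" "Fp_independent p cs" "eigen_ratios ` A \<subseteq> Fp_span p cs"
  shows "\<exists>bs. Fp_basis p A bs \<and> map eigen_ratios bs = cs"
proof -
  define bs where "bs = map (inv_into A eigen_ratios) cs"
  have bs: "set bs \<subseteq> A" "map eigen_ratios bs = cs"
    using cs(1) unfolding bs_def map_map by (auto simp: inv_into_into f_inv_into_f intro!: map_idI)
  have "\<exists>!m. bounded_exps p (length bs) m \<and> (\<exists>c. a = mat c ** mpow_prod bs m)" if a: "a \<in> A" for a
  proof -
    have length_bs: "length bs = length cs" using bs(2) by auto
    obtain m where m: "bounded_exps p (length cs) m" "power_prod cs m = eigen_ratios a"
      using cs(3) a unfolding Fp_span_def by auto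
    then have "\<exists>c. a = mat c ** mpow_prod bs m"
      using eigen_ratios_eq_imp_scalar[OF a, of "mpow_prod bs m"] mpow_prod_in_A[OF bs(1)] bs(2) by auto
    moreover have "m' = m" if "bounded_exps p (length cs) m'" "a = mat c ** mpow_prod bs m'" for m' c
    proof -
      have "c \<noteq> 0" using invertible_ex_nth_nonzero[OF invertible_if_in_A[OF a]] that(2) by auto
      then have "power_prod cs m' = power_prod cs m"
        using that(2) m(2) mpow_prod_in_A[OF bs(1)] bs(2) eigen_ratios_mat_mult by simp
      then show ?thesis using cs(2) that(1) m(1) unfolding Fp_independent_def inj_on_def by blast
    qed
    ultimately show ?thesis using m(1) unfolding length_bs by blast
  qed
  then have "Fp_basis p A bs" using bs(1) unfolding Fp_basis_iff by blast
  then show ?thesis using bs(2) by blast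
qed

lemma centralizer_commutator_scalar:
  assumes y: "y \<in> centralizer_preimage A" and a: "a \<in> A"
  obtains c where "y ** a = mat c ** (a ** y)" and "c ^ p = 1"
    and "\<And>w. y ** a = mat w ** (a ** y) \<Longrightarrow> w = c"
proof -
  obtain c where c: "invertible y" "y ** a = mat c ** (a ** y)"
    using y a unfolding centralizer_preimage_def by auto
  obtain s where "s \<noteq> 0" "mpow a p = mat s" using mpow_p_eq_mat[OF a] by blast
  then have "c ^ p = 1" using commutator_scalar_power_p c by blast
  moreover have "w = c" if "y ** a = mat w ** (a ** y)" for w
    using commutator_scalar_unique[OF invertible_mult[OF invertible_if_in_A[OF a] c(1)] that c(2)] .
  ultimately show ?thesis using that c(2) by blast
qed

text \<open>The commutator scalar of an element of the centralizer with a fixed \<open>a \<in> A\<close> is a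
  \<open>p\<close>-th root of unity, and it depends continuously on the element; on a connected
  centralizer it is therefore constantly 1, its value at the identity.\<close>
lemma commutator_scalar_eq_1:
  assumes conn: "connected (centralizer_preimage A)"
    and x: "x \<in> centralizer_preimage A" and a: "a \<in> A" and xa: "x ** a = mat z ** (a ** x)"
  shows "z = 1"
proof (rule ccontr)
  assume "z \<noteq> 1"
  define C where "C = centralizer_preimage A"
  define Z where "Z = {z::complex. z ^ p = 1 \<and> z \<noteq> 1}"
  define E1 where "E1 = {y::complex^'n^'n. y ** a = mat 1 ** (a ** y)}"
  define E2 where "E2 = (\<Union>z\<in>Z. {y::complex^'n^'n. y ** a = mat z ** (a ** y)})"
  have "finite Z"
    unfolding Z_def using finite_roots_unity[of p] prime_gt_0_nat[OF prime_p]
    by (auto intro: rev_finite_subset)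
  then have closed: "closed E1" "closed E2"
    unfolding E1_def E2_def using closed_scalar_commutator by (blast, intro closed_UN, auto)
  have "C \<subseteq> E1 \<union> E2"
  proof
    fix y assume "y \<in> C"
    then obtain c where "y ** a = mat c ** (a ** y)" "c ^ p = 1"
      using centralizer_commutator_scalar[OF _ a] unfolding C_def by metis
    then show "y \<in> E1 \<union> E2" unfolding E1_def E2_def Z_def by (cases "c = 1") auto
  qed
  moreover have "E1 \<inter> E2 \<inter> C = {}"
  proof (rule equals0I)
    fix y assume "y \<in> E1 \<inter> E2 \<inter> C"
    then obtain w where w: "w \<in> Z" "y ** a = mat 1 ** (a ** y)" "y ** a = mat w ** (a ** y)" "y \<in> C"
      unfolding E1_def E2_def by blast
    obtain c where c: "\<And>w. y ** a = mat w ** (a ** y) \<Longrightarrow> w = c"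
      using centralizer_commutator_scalar[OF w(4)[unfolded C_def] a] by blast
    have "w = 1" using c[OF w(2)] c[OF w(3)] by simp
    then show False using w(1) unfolding Z_def by blast
  qed
  moreover have "mat 1 \<in> E1 \<inter> C"
    unfolding E1_def C_def centralizer_preimage_def invertible_def by (auto intro: exI[of _ 1])
  then have "E1 \<inter> C \<noteq> {}" by blast
  moreover have "z \<in> Z"
  proof -
    obtain c where "c ^ p = 1" and c: "\<And>w. x ** a = mat w ** (a ** x) \<Longrightarrow> w = c"
      using centralizer_commutator_scalar[OF x a] by blast
    then show ?thesis using c[OF xa] \<open>z \<noteq> 1\<close> unfolding Z_def by simp
  qed
  then have "E2 \<inter> C \<noteq> {}" using x xa unfolding E2_def C_def by blast
  ultimately have "\<not> connected C" unfolding connected_closed using closed by blast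
  then show False using conn unfolding C_def by blast
qed

lemma commutator_scalar_conj_perm_mat:
  assumes "bij \<pi>" and "a \<in> A" and "\<forall>i. eigen_ratios a $ \<pi> i = w * eigen_ratios a $ i" and "w \<noteq> 0"
  defines "x \<equiv> matrix_inv g ** perm_mat \<pi> ** g"
  shows "x ** a = mat (1 / w) ** (a ** x)"
proof -
  have "diag_form a $ \<pi> i $ \<pi> i = w * diag_form a $ i $ i" for i
    using assms(3) diag_form_nth_nonzero[OF assms(2)] unfolding eigen_ratios_def by (simp add: field_simps)
  then have twist: "diag_form a ** perm_mat \<pi> = mat w ** (perm_mat \<pi> ** diag_form a)"
    by (rule diagonal_mat_mult_perm_mat[OF diagonal_diag_form[OF assms(2)]])
  have x: "diag_form x = perm_mat \<pi>" unfolding x_def by (rule diag_form_of_conj)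
  have "diag_form (mat (1 / w) ** (a ** x)) = mat (1 / w) ** (diag_form a ** perm_mat \<pi>)"
    by (simp add: diag_form_mult diag_form_mat x)
  also have "\<dots> = perm_mat \<pi> ** diag_form a"
    using assms(4) by (simp add: twist matrix_mul_assoc mat_mult_mat)
  also have "\<dots> = diag_form (x ** a)" by (simp add: diag_form_mult x)
  finally show ?thesis by (rule diag_form_inject[symmetric])
qed

lemma character_trivial_if_connected_centralizer:
  fixes \<theta> :: "complex^'n \<Rightarrow> complex"
  assumes conn: "connected (centralizer_preimage A)"
    and \<theta>: "multiplicative_on (eigen_ratios ` A) \<theta>" "\<forall>u\<in>eigen_ratios ` A. \<theta> u ^ p = 1"
    and trivial: "\<forall>u\<in>eigen_ratios ` A. (\<Sum>j\<in>UNIV. u $ j) \<noteq> 0 \<longrightarrow> \<theta> u = 1"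
  shows "\<forall>u\<in>eigen_ratios ` A. \<theta> u = 1"
proof
  fix u assume "u \<in> eigen_ratios ` A"
  then obtain a where a: "a \<in> A" "u = eigen_ratios a" by blast
  have \<theta>_nonzero: "\<forall>u\<in>eigen_ratios ` A. \<theta> u \<noteq> 0"
    using \<theta>(2) prime_gt_0_nat[OF prime_p] by (metis power_0_left less_not_refl zero_neq_one)
  have "\<forall>u\<in>eigen_ratios ` A. \<forall>i. u $ i \<noteq> 0" using eigen_ratios_nth_nonzero by blast
  from card_twisted_coords_eq[OF elem_abelian_pgroup_eigen_ratios this \<theta>(1) \<theta>_nonzero trivial]
  obtain \<pi> where \<pi>: "bij \<pi>" "\<forall>i. \<forall>u\<in>eigen_ratios ` A. u $ \<pi> i = \<theta> u * u $ i"
    using ex_bij_twisting_coords[OF \<theta>_nonzero] by blast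
  define x where "x = matrix_inv g ** perm_mat \<pi> ** g"
  have "\<theta> u \<noteq> 0" using \<theta>_nonzero a by blast
  have xa: "x ** b = mat (1 / \<theta> (eigen_ratios b)) ** (b ** x)" if "b \<in> A" for b
    using commutator_scalar_conj_perm_mat[OF \<pi>(1) that] \<pi>(2) \<theta>_nonzero that unfolding x_def by simp
  have "invertible x"
    unfolding x_def
    using invertible_mult[OF invertible_mult[OF invertible_matrix_inv_g invertible_perm_mat[OF \<pi>(1)]]
        invertible_g] .
  then have "x \<in> centralizer_preimage A"
    unfolding centralizer_preimage_def using xa by blast
  then have "1 / \<theta> u = 1" using commutator_scalar_eq_1[OF conn _ a(1) xa[OF a(1)]] a(2) by simp
  then show "\<theta> u = 1" by simp
qed

lemma Fp_basis_with_nonzero_sums: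
  assumes conn: "connected (centralizer_preimage A)"
  obtains cs where "set cs \<subseteq> {u \<in> eigen_ratios ` A. (\<Sum>j\<in>UNIV. u $ j) \<noteq> 0}"
    and "Fp_independent p cs" and "eigen_ratios ` A \<subseteq> Fp_span p cs"
proof -
  interpret elem_abelian_pgroup "eigen_ratios ` A" p
    by (rule elem_abelian_pgroup_eigen_ratios)
  define T where "T = {u \<in> eigen_ratios ` A. (\<Sum>j\<in>UNIV. u $ j) \<noteq> 0}"
  have "\<not> (\<exists>\<theta>::complex^'n \<Rightarrow> complex. multiplicative_on (eigen_ratios ` A) \<theta> \<and>
      (\<forall>u\<in>eigen_ratios ` A. \<theta> u ^ p = 1) \<and> (\<forall>u\<in>T. \<theta> u = 1) \<and> (\<exists>u\<in>eigen_ratios ` A. \<theta> u \<noteq> 1))"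
    (is "\<not> ?nontrivial_character")
  proof
    assume ?nontrivial_character
    then obtain \<theta> :: "complex^'n \<Rightarrow> complex" and u
      where \<theta>: "multiplicative_on (eigen_ratios ` A) \<theta>" "\<forall>u\<in>eigen_ratios ` A. \<theta> u ^ p = 1"
        "\<forall>u\<in>T. \<theta> u = 1" and u: "u \<in> eigen_ratios ` A" "\<theta> u \<noteq> 1"
      by blast
    have "\<forall>u\<in>eigen_ratios ` A. (\<Sum>j\<in>UNIV. u $ j) \<noteq> 0 \<longrightarrow> \<theta> u = 1"
      using \<theta>(3) unfolding T_def by blast
    then show False
      using character_trivial_if_connected_centralizer[OF conn \<theta>(1,2)] u by blast
  qed
  moreover have "T \<subseteq> eigen_ratios ` A" unfolding T_def by blast
  note basis_or_character[OF this primitive_root_of_unity[OF p_gt_1]]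
  ultimately obtain cs where "set cs \<subseteq> T" "Fp_independent p cs" "eigen_ratios ` A \<subseteq> Fp_span p cs"
    by blast
  then show ?thesis unfolding T_def by (rule that)
qed

end

theorem theorem4p31:
  fixes p :: nat and A :: "(complex^'n^'n) set"
  assumes "prime p" and "odd p" and "p dvd CARD('n)"
    and "elem_abelian_preimage p A"
    and "toral A"
    and "connected (centralizer_preimage A)"
  shows "\<exists>bs. Fp_basis p A bs \<and> (\<forall>b\<in>set bs. \<not> conj_to_e p b)"
proof -
  obtain g :: "complex^'n^'n" where "invertible g" "\<forall>a\<in>A. diagonal_mat (g ** a ** matrix_inv g)"
    using assms(5) unfolding toral_def by blast
  interpret simultaneous_diagonalization p A g
    using assms(1,4) \<open>invertible g\<close> \<open>\<forall>a\<in>A. _\<close> by unfold_locales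
  obtain cs where cs: "set cs \<subseteq> {u \<in> eigen_ratios ` A. (\<Sum>j\<in>UNIV. u $ j) \<noteq> 0}"
    "Fp_independent p cs" "eigen_ratios ` A \<subseteq> Fp_span p cs"
    using Fp_basis_with_nonzero_sums[OF assms(6)] .
  then obtain bs where bs: "Fp_basis p A bs" "map eigen_ratios bs = cs"
    using Fp_basis_lift by blast
  have "trace b \<noteq> 0" if "b \<in> set bs" for b
  proof -
    have "eigen_ratios b \<in> set cs" using that bs(2) by auto
    then have "(\<Sum>j\<in>UNIV. eigen_ratios b $ j) \<noteq> 0" using cs(1) by blast
    then show ?thesis using sum_eigen_ratios[of b] by auto
  qed
  moreover have "p > 1" using assms(1) prime_gt_1_nat by blast
  ultimately show ?thesis
    using bs(1) trace_eq_0_if_conj_to_e[OF _ assms(3)] by blast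
qed

end
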